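(* Let $P$ be the Borel probability measure on $\mathbb{R}^2$ that is uniform on its support $\{(x,y)\in\mathbb{R}^2:0\le x\le2,\ y=0\}$. For $n\in\mathbb{N}$, let $\alpha_n:=\{(a_i,1):1\le i\le n\}$ be an optimal set of $n$-points for $P$ with respect to the constraint $S=\{(x,1):0\le x\le\frac{28}{15}\}$ (i.e., the elements of the optimal set lie on the line $y=1$ between $(0,1)$ and $(\frac{28}{15},1)$), with $0\le a_1<a_2<\cdots<a_n\le\frac{28}{15}$. Then $\alpha_1=\{(1,1)\}$, and for $1\le n\le7$, $$\alpha_n=\Big\{\Big(\frac{2i-1}{n},1\Big):1\le i\le n\Big\}.$$ On the other hand, for $n\ge8$, $$a_i=\begin{cases}\frac{28(2i-1)}{15(2n-1)} & \text{if }1\le i\le n-1,\\ \frac{28}{15} & \text{if } i=n,\end{cases}$$ and the quantization error for $n$-points is $V_n=\dfrac{7(5788(n-1)n+3015)}{10125(1-2n)^2}$.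
   Context: Here $r=2$ and distances on $\mathbb{R}^2$ are Euclidean. For finite nonempty $\alpha\subseteq S$, $V(P;\alpha)=\int\min_{p\in\alpha}\|x-p\|^2\,dP(x)$; the $n$th constrained quantization error is $V_n=V_n(P)=\inf\{V(P;\alpha):\alpha\subseteq S,\ 1\le\mathrm{card}(\alpha)\le n\}$; an optimal set of $n$-points with respect to $S$ is a set $\alpha\subseteq S$ with $1\le\mathrm{card}(\alpha)\le n$ and $V(P;\alpha)=V_n$. *)

theory Defs
  imports "HOL-Analysis.Analysis"
begin

text \<open>
  The plane is \<^typ>\<open>real \<times> real\<close>, whose library norm is the Euclidean one.

  The case r = 2 of constrained quantization. The integral is the Bochner integral, which
  is 0 on non-integrable functions; this does not matter for measures with finite second
  moment, such as the compactly supported one below.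
\<close>

definition distortion :: "'a::euclidean_space measure \<Rightarrow> 'a set \<Rightarrow> real" where
  "distortion P \<alpha> = (\<integral>x. (MIN p\<in>\<alpha>. (norm (x - p))\<^sup>2) \<partial>P)"

definition constrained_quantization_error ::
    "'a::euclidean_space measure \<Rightarrow> 'a set \<Rightarrow> nat \<Rightarrow> real" where
  "constrained_quantization_error P S n =
     Inf {distortion P \<alpha> | \<alpha>. \<alpha> \<subseteq> S \<and> finite \<alpha> \<and> 1 \<le> card \<alpha> \<and> card \<alpha> \<le> n}"

definition optimal_set_of_points ::
    "'a::euclidean_space measure \<Rightarrow> 'a set \<Rightarrow> nat \<Rightarrow> 'a set \<Rightarrow> bool" where
  "optimal_set_of_points P S n \<alpha> \<longleftrightarrow>
     \<alpha> \<subseteq> S \<and> finite \<alpha> \<and> 1 \<le> card \<alpha> \<and> card \<alpha> \<le> n \<and>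
     distortion P \<alpha> = constrained_quantization_error P S n"

text \<open>
  The segment is a Lebesgue null set of the plane, so the uniform distribution on it
  (normalized arc length) is the image of the uniform distribution on \<open>{0..2}\<close>.
\<close>

definition uniform_segment :: "(real \<times> real) measure" where
  "uniform_segment = distr (uniform_measure lborel {0..2}) borel (\<lambda>x. (x, 0))"

definition constraint_segment :: "(real \<times> real) set" where
  "constraint_segment = {(x, 1) | x. 0 \<le> x \<and> x \<le> 28 / 15}"

end

theory Submission
  imports Defs
begin

text \<open>
  Let m be the largest abscissa of the k points used. The integral of the squared distance
  from (x, 0) is, up to constants, a sum of cubes of half gaps: one for the left end, two for
  each gap between neighbours, and one for the right end. Bound every cube by its tangent,
  at h for the first 2k - 1 of them and at e for the last: the resulting bound is affine
  in m and k alone, with slope \<open>h\<^sup>2 - e\<^sup>2\<close> in m. If \<open>(2 n - 1) h = 2 - e\<close>, it is at least the error of the n points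
  \<open>(2 i - 1) h\<close> once \<open>h = e\<close>, or \<open>h \<le> e\<close> and all points lie left of \<open>2 - e\<close>. The first case,
  \<open>h = e = 1 / n\<close>, is admissible up to n = 7, because then \<open>2 - 1 / n \<le> 28 / 15\<close>; from n = 8 on
  the right end of the constraint is active, with \<open>e = 2 / 15\<close> and \<open>h = 28 / (15 (2 n - 1)) < e\<close>.
\<close>

section \<open>Squared distance to a finite set on the line\<close>

definition sqdist :: "real set \<Rightarrow> real \<Rightarrow> real" where
  "sqdist A x = (MIN a\<in>A. (x - a)\<^sup>2)"

text \<open>The configuration whose left gap from 0 and whose half gaps between neighbours all equal
  \<open>h\<close>: the equality case of the tangent bound.\<close>

definition odd_multiples :: "real \<Rightarrow> nat \<Rightarrow> real set" where
  "odd_multiples h k = (\<lambda>i. (2 * real i - 1) * h) ` {1..k}"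

lemma sqdist_insert:
  "finite A \<Longrightarrow> A \<noteq> {} \<Longrightarrow> sqdist (insert b A) x = min ((x - b)\<^sup>2) (sqdist A x)"
  by (simp add: sqdist_def)

lemma sqdist_eqI:
  assumes "finite A" "m \<in> A" "\<And>a. a \<in> A \<Longrightarrow> (x - m)\<^sup>2 \<le> (x - a)\<^sup>2"
  shows "sqdist A x = (x - m)\<^sup>2"
  unfolding sqdist_def using assms by (intro Min_eqI) auto

lemma sqdist_beyond_Max:
  assumes "finite A" "A \<noteq> {}" "Max A \<le> x"
  shows "sqdist A x = (x - Max A)\<^sup>2"
proof (rule sqdist_eqI)
  fix a assume "a \<in> A"
  then have "a \<le> Max A" using assms by simp
  then have "x - Max A \<le> x - a" "0 \<le> x - Max A" using assms(3) by linarith+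
  then show "(x - Max A)\<^sup>2 \<le> (x - a)\<^sup>2" by (rule power_mono)
qed (use assms in auto)

lemma sqdist_le: "finite A \<Longrightarrow> a \<in> A \<Longrightarrow> sqdist A x \<le> (x - a)\<^sup>2"
  by (simp add: sqdist_def)

lemma continuous_on_sqdist:
  assumes "finite A" "A \<noteq> {}"
  shows "continuous_on S (sqdist A)"
  using assms
proof (induction rule: finite_ne_induct)
  case (singleton a)
  then show ?case by (simp add: sqdist_def) (intro continuous_intros)
next
  case (insert b A)
  then show ?case by (simp add: sqdist_insert cong: continuous_on_cong) (intro continuous_intros)
qed

section \<open>Exact integrals, built up from left to right\<close>

lemma has_integral_square_shift:
  fixes p q m :: real
  assumes "p \<le> q"
  shows "((\<lambda>x. (x - m)\<^sup>2) has_integral ((q - m) ^ 3 - (p - m) ^ 3) / 3) {p..q}"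
proof -
  have "((\<lambda>x. (x - m)\<^sup>2) has_integral (q - m) ^ 3 / 3 - (p - m) ^ 3 / 3) {p..q}"
    by (rule fundamental_theorem_of_calculus[OF assms])
       (auto intro!: derivative_eq_intros simp: has_real_derivative_iff_has_vector_derivative[symmetric])
  then show ?thesis by (simp add: diff_divide_distrib)
qed

text \<open>Beyond \<open>Max A\<close> only that last point matters, so the tail is a single cube.
  The end \<open>r\<close> serves both as the midpoint before a further point and as the end of the
  segment.\<close>

lemma has_integral_sqdist_tail:
  assumes A: "finite A" "A \<noteq> {}" and "0 \<le> Max A" "Max A \<le> r"
    and I: "(sqdist A has_integral I) {0..Max A}"
  shows "(sqdist A has_integral I + (r - Max A) ^ 3 / 3) {0..r}"
proof (rule has_integral_combine[OF assms(3,4) I])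
  have "((\<lambda>x. (x - Max A)\<^sup>2) has_integral (r - Max A) ^ 3 / 3) {Max A..r}"
    using has_integral_square_shift[OF assms(4), of "Max A"] by simp
  then show "(sqdist A has_integral (r - Max A) ^ 3 / 3) {Max A..r}"
    by (rule has_integral_eq[rotated]) (simp add: sqdist_beyond_Max A)
qed

text \<open>Half of the gap is served by the old maximum and half by \<open>b\<close>. Each half has
  length \<open>(b - Max A) / 2\<close> and contributes a third of its cube; together this is the
  twelfth.\<close>

lemma has_integral_sqdist_insert:
  assumes A: "finite A" "A \<noteq> {}" and nn: "0 \<le> Max A" and b: "Max A < b"
    and I: "(sqdist A has_integral I) {0..Max A}"
  shows "(sqdist (insert b A) has_integral I + (b - Max A) ^ 3 / 12) {0..b}"
proof -
  define m where "m = Max A"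
  \<comment> \<open>The midpoint is where the nearest point changes from \<open>m\<close> to
    \<open>b\<close>.\<close>
  define c where "c = (m + b) / 2"
  have mc: "m \<le> c" "c \<le> b" using b by (auto simp: m_def c_def)
  have ins: "sqdist (insert b A) x = min ((x - b)\<^sup>2) (sqdist A x)" for x
    using A by (rule sqdist_insert)
  have low: "sqdist (insert b A) x = sqdist A x" if "x \<le> c" for x
  proof -
    \<comment> \<open>Left of \<open>c\<close> it suffices to compare \<open>b\<close> with
      \<open>m\<close>, since the other points of \<open>A\<close> can only lower
      \<open>sqdist A x\<close> further.\<close>
    have "sqdist A x \<le> (x - m)\<^sup>2" unfolding m_def by (rule sqdist_le) (use A in auto)
    also have "\<dots> \<le> (x - b)\<^sup>2"
    proof -
      have "(x - b)\<^sup>2 - (x - m)\<^sup>2 = 2 * (b - m) * (c - x)"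
        unfolding c_def by (simp add: power2_eq_square field_simps)
      moreover have "\<dots> \<ge> 0" using that b by (simp add: m_def)
      ultimately show ?thesis by linarith
    qed
    finally show ?thesis by (simp add: ins)
  qed
  have high: "sqdist (insert b A) x = (x - b)\<^sup>2" if "c \<le> x" for x
  proof -
    have "(x - m)\<^sup>2 - (x - b)\<^sup>2 = 2 * (b - m) * (x - c)"
      unfolding c_def by (simp add: power2_eq_square field_simps)
    moreover have "\<dots> \<ge> 0" using that b by (simp add: m_def)
    moreover have "sqdist A x = (x - m)\<^sup>2"
      unfolding m_def by (rule sqdist_beyond_Max) (use A that mc in \<open>auto simp: m_def\<close>)
    ultimately show ?thesis by (simp add: ins)
  qed
  have "(sqdist A has_integral I + (c - m) ^ 3 / 3) {0..c}"
    unfolding m_def using A nn I mc by (intro has_integral_sqdist_tail) (auto simp: m_def)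
  then have 1: "(sqdist (insert b A) has_integral I + (c - m) ^ 3 / 3) {0..c}"
    by (rule has_integral_eq[rotated]) (simp add: low)
  have "((\<lambda>x. (x - b)\<^sup>2) has_integral ((b - b) ^ 3 - (c - b) ^ 3) / 3) {c..b}"
    using mc by (intro has_integral_square_shift)
  then have 2: "(sqdist (insert b A) has_integral ((b - b) ^ 3 - (c - b) ^ 3) / 3) {c..b}"
    by (rule has_integral_eq[rotated]) (simp add: high)
  have "I + (c - m) ^ 3 / 3 + ((b - b) ^ 3 - (c - b) ^ 3) / 3 = I + (b - m) ^ 3 / 12"
    unfolding c_def by (simp add: power3_eq_cube field_simps)
  moreover have "(sqdist (insert b A) has_integral
      I + (c - m) ^ 3 / 3 + ((b - b) ^ 3 - (c - b) ^ 3) / 3) {0..b}"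
    by (rule has_integral_combine[OF _ mc(2) 1 2]) (use nn mc in \<open>auto simp: m_def\<close>)
  ultimately show ?thesis unfolding m_def by (simp only:)
qed

lemma has_integral_sqdist_singleton:
  "0 \<le> a \<Longrightarrow> (sqdist {a} has_integral a ^ 3 / 3) {0..a}"
  using has_integral_square_shift[of 0 a a] by (simp add: sqdist_def[abs_def])

section \<open>Tangent bound and its equality case\<close>

text \<open>The cube exceeds its tangent by \<open>(u - h)\<^sup>2 * (u + 2 * h) / 3\<close>. The
  last factor is positive, which gives the bound and leaves \<open>u = h\<close> as the only case of
  equality.\<close>

lemma cube_ge_tangent:
  fixes u h :: real
  assumes "0 \<le> u" "0 < h"
  shows "h\<^sup>2 * u - 2 * h ^ 3 / 3 \<le> u ^ 3 / 3"
    and "u ^ 3 / 3 = h\<^sup>2 * u - 2 * h ^ 3 / 3 \<Longrightarrow> u = h"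
proof -
  have *: "u ^ 3 / 3 - (h\<^sup>2 * u - 2 * h ^ 3 / 3) = (u - h)\<^sup>2 * (u + 2 * h) / 3"
    by (simp add: power3_eq_cube power2_eq_square field_simps)
  have "0 \<le> (u - h)\<^sup>2 * (u + 2 * h) / 3" using assms by simp
  then show "h\<^sup>2 * u - 2 * h ^ 3 / 3 \<le> u ^ 3 / 3" using * by linarith
  assume "u ^ 3 / 3 = h\<^sup>2 * u - 2 * h ^ 3 / 3"
  then have "(u - h)\<^sup>2 * (u + 2 * h) / 3 = 0" using * by linarith
  then show "u = h" using assms by auto
qed

lemma odd_multiples_Suc:
  "odd_multiples h (Suc k) = insert ((2 * real k + 1) * h) (odd_multiples h k)"
proof -
  have "{1..Suc k} = insert (Suc k) {1..k}" by auto
  then show ?thesis by (simp add: odd_multiples_def algebra_simps)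
qed

lemma odd_multiples_1: "odd_multiples h (Suc 0) = {h}"
  by (simp add: odd_multiples_def)

lemma odd_multiples_basic:
  assumes "1 \<le> k"
  shows "finite (odd_multiples h k)" "odd_multiples h k \<noteq> {}"
  using assms by (auto simp: odd_multiples_def)

lemma Max_odd_multiples:
  assumes "0 \<le> h" "1 \<le> k"
  shows "Max (odd_multiples h k) = (2 * real k - 1) * h"
  unfolding odd_multiples_def
  by (rule Max_eqI) (use assms in \<open>auto intro: mult_right_mono\<close>)

text \<open>With points added in increasing order, the first contributes one cube and every later
  one two, hence \<open>2 * real (card A) - 1\<close> tangents. The lengths involved add up to
  \<open>Max A\<close>, so the linear parts sum to \<open>h\<^sup>2 * Max A\<close>. Equality forces
  every one of these lengths to be \<open>h\<close>.\<close>

lemma integral_sqdist_lower_bound: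
  assumes "finite A" "A \<noteq> {}" "A \<subseteq> {0..}" "0 < h"
  obtains I where "(sqdist A has_integral I) {0..Max A}"
    and "h\<^sup>2 * Max A - (2 * real (card A) - 1) * (2 * h ^ 3 / 3) \<le> I"
    and "I = h\<^sup>2 * Max A - (2 * real (card A) - 1) * (2 * h ^ 3 / 3) \<Longrightarrow> A = odd_multiples h (card A)"
proof -
  \<comment> \<open>The conditions on \<open>A\<close> belong to the induction formula because the
    set varies; the empty case is then vacuous.\<close>
  have "A \<noteq> {} \<longrightarrow> A \<subseteq> {0..} \<longrightarrow> (\<exists>I. (sqdist A has_integral I) {0..Max A}
    \<and> h\<^sup>2 * Max A - (2 * real (card A) - 1) * (2 * h ^ 3 / 3) \<le> I
    \<and> (I = h\<^sup>2 * Max A - (2 * real (card A) - 1) * (2 * h ^ 3 / 3) \<longrightarrow> A = odd_multiples h (card A)))"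
    using assms(1)
  proof (induction rule: finite_linorder_max_induct)
    case empty
    then show ?case by simp
  next
    case (insert b A)
    show ?case
    proof (intro impI)
      assume nn: "insert b A \<subseteq> {0..}"
      show "\<exists>I. (sqdist (insert b A) has_integral I) {0..Max (insert b A)}
        \<and> h\<^sup>2 * Max (insert b A) - (2 * real (card (insert b A)) - 1) * (2 * h ^ 3 / 3) \<le> I
        \<and> (I = h\<^sup>2 * Max (insert b A) - (2 * real (card (insert b A)) - 1) * (2 * h ^ 3 / 3)
            \<longrightarrow> insert b A = odd_multiples h (card (insert b A)))"
      \<comment> \<open>A single point is the true base case: its only cube is that of its distance
        from 0.\<close>
      proof (cases "A = {}")
        case True
        show ?thesis
          by (rule exI[of _ "b ^ 3 / 3"])
             (use True nn cube_ge_tangent[OF _ assms(4), of b] has_integral_sqdist_singleton[of b]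
               in \<open>auto simp: odd_multiples_1\<close>)
      next
        case False
        define m where "m = Max A"
        define k where "k = card A"
        have k1: "1 \<le> k" using False insert.hyps(1) by (simp add: k_def Suc_leI card_gt_0_iff)
        have mA: "m \<in> A" using False insert.hyps(1) by (simp add: m_def)
        then have mb: "m < b" and m0: "0 \<le> m" using insert.hyps nn by auto
        obtain I where I: "(sqdist A has_integral I) {0..m}"
          and ge: "h\<^sup>2 * m - (2 * real k - 1) * (2 * h ^ 3 / 3) \<le> I"
          and eq: "I = h\<^sup>2 * m - (2 * real k - 1) * (2 * h ^ 3 / 3) \<longrightarrow> A = odd_multiples h k"
          using insert.IH nn False unfolding m_def k_def by auto
        have Mx: "Max (insert b A) = b"
          using insert.hyps by (intro Max_eqI) (auto intro: less_imp_le)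
        have cd: "card (insert b A) = Suc k" using insert.hyps by (auto simp: k_def)
        have int: "(sqdist (insert b A) has_integral I + (b - m) ^ 3 / 12) {0..b}"
          unfolding m_def using False insert.hyps(1) m0 mb I
          by (intro has_integral_sqdist_insert) (auto simp: m_def)
        define u where "u = (b - m) / 2"
        have b: "b = m + 2 * u" and u0: "0 \<le> u" using mb by (auto simp: u_def field_simps)
        have cube: "(b - m) ^ 3 / 12 = 2 * (u ^ 3 / 3)"
          by (simp add: u_def power3_eq_cube field_simps)
        \<comment> \<open>One more point raises the bound by two tangent values at the half gap
          \<open>u\<close>.\<close>
        have split: "h\<^sup>2 * b - (2 * real (Suc k) - 1) * (2 * h ^ 3 / 3) =
          (h\<^sup>2 * m - (2 * real k - 1) * (2 * h ^ 3 / 3)) + 2 * (h\<^sup>2 * u - 2 * h ^ 3 / 3)"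
          by (simp add: b field_simps)
        note tan = cube_ge_tangent[OF u0 assms(4)]
        have "insert b A = odd_multiples h (Suc k)"
          if e: "I + (b - m) ^ 3 / 12 = h\<^sup>2 * b - (2 * real (Suc k) - 1) * (2 * h ^ 3 / 3)"
        proof -
          \<comment> \<open>The sum is tight and both parts are bounded below, so each part is
            tight: one determines \<open>A\<close> by induction, the other gives
            \<open>u = h\<close>.\<close>
          have "p = r \<and> q = s" if "p + 2 * q = r + 2 * s" "r \<le> p" "s \<le> q" for p q r s :: real
            using that by linarith
          from this[OF e[unfolded split cube] ge tan(1)] have A: "A = odd_multiples h k" and u: "u = h" using eq tan(2) by auto
          have "m = (2 * real k - 1) * h"
            unfolding m_def A by (rule Max_odd_multiples) (use assms(4) k1 in auto)
          then have "b = (2 * real k + 1) * h" by (simp add: b u algebra_simps)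
          then show ?thesis by (simp add: A odd_multiples_Suc)
        qed
        moreover have "h\<^sup>2 * b - (2 * real (Suc k) - 1) * (2 * h ^ 3 / 3) \<le> I + (b - m) ^ 3 / 12"
          unfolding split cube by (intro add_mono mult_left_mono ge tan(1)) simp
        ultimately show ?thesis unfolding Mx cd using int by blast
      qed
    qed
  qed
  then show ?thesis using assms that by blast
qed

text \<open>The interval splits into \<open>2 * real k - 1\<close> pieces of length
  \<open>h\<close>, each contributing \<open>h ^ 3 / 3\<close>.\<close>

lemma has_integral_sqdist_odd_multiples:
  assumes "0 < h" "1 \<le> k"
  shows "(sqdist (odd_multiples h k) has_integral (2 * real k - 1) * h ^ 3 / 3)
    {0..(2 * real k - 1) * h}"
  using assms(2)
proof (induction k rule: nat_induct_at_least)
  case base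
  then show ?case using has_integral_sqdist_singleton[of h] assms(1) by (simp add: odd_multiples_1)
next
  case (Suc k)
  define b where "b = (2 * real k + 1) * h"
  have M: "Max (odd_multiples h k) = (2 * real k - 1) * h"
    using Max_odd_multiples Suc.hyps assms(1) by simp
  have "(sqdist (insert b (odd_multiples h k)) has_integral
      (2 * real k - 1) * h ^ 3 / 3 + (b - (2 * real k - 1) * h) ^ 3 / 12) {0..b}"
    unfolding M[symmetric]
    by (rule has_integral_sqdist_insert)
       (use Suc assms(1) odd_multiples_basic[OF Suc.hyps] in \<open>auto simp: M b_def\<close>)
  moreover have "(2 * real k - 1) * h ^ 3 / 3 + (b - (2 * real k - 1) * h) ^ 3 / 12
      = (2 * real (Suc k) - 1) * h ^ 3 / 3"
    by (simp add: b_def power3_eq_cube field_simps)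
  moreover have "b = (2 * real (Suc k) - 1) * h" by (simp add: b_def)
  ultimately show ?case by (simp only: odd_multiples_Suc flip: b_def)
qed

section \<open>The error on the whole segment\<close>

text \<open>Here \<open>e\<close> is the distance from the last of the \<open>n\<close> candidate
  points to 2. Four estimates are added: tangents at \<open>h\<close> up to the largest point, the
  tangent at \<open>e\<close> for the tail, monotonicity in the number of points, and the sign of
  the slope term.\<close>

lemma integral_sqdist_segment_lower_bound:
  assumes A: "finite A" "A \<noteq> {}" "A \<subseteq> {0..2}" "card A \<le> n"
    and h: "0 < h" "h \<le> e" "(2 * real n - 1) * h = 2 - e"
    and e: "e = h \<or> A \<subseteq> {..2 - e}"
  shows "((2 * real n - 1) * h ^ 3 + e ^ 3) / 3 \<le> integral {0..2} (sqdist A)"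
    and "integral {0..2} (sqdist A) = ((2 * real n - 1) * h ^ 3 + e ^ 3) / 3 \<Longrightarrow> card A = n
      \<Longrightarrow> A = odd_multiples h n"
proof -
  define m where "m = Max A"
  have "m \<in> A" using A by (simp add: m_def)
  then have m: "0 \<le> m" "m \<le> 2" and me: "e = h \<or> m \<le> 2 - e" using A e by auto
  have "A \<subseteq> {0..}" using A(3) by auto
  then obtain I where I: "(sqdist A has_integral I) {0..m}"
    and ge: "h\<^sup>2 * m - (2 * real (card A) - 1) * (2 * h ^ 3 / 3) \<le> I"
    and eq: "I = h\<^sup>2 * m - (2 * real (card A) - 1) * (2 * h ^ 3 / 3) \<Longrightarrow> A = odd_multiples h (card A)"
    using integral_sqdist_lower_bound[of A h] A(1,2) h(1) unfolding m_def by metis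
  have "(sqdist A has_integral I + (2 - m) ^ 3 / 3) {0..2}"
    unfolding m_def using A(1,2) m I by (intro has_integral_sqdist_tail) (auto simp: m_def)
  then have int: "integral {0..2} (sqdist A) = I + (2 - m) ^ 3 / 3" by (rule integral_unique)
  have tail: "e\<^sup>2 * (2 - m) - 2 * e ^ 3 / 3 \<le> (2 - m) ^ 3 / 3"
    using m h by (intro cube_ge_tangent) auto
  \<comment> \<open>Fewer points subtract fewer constants, so the bound for exactly \<open>n\<close>
    points is the smallest.\<close>
  have mono: "(2 * real (card A) - 1) * (2 * h ^ 3 / 3) \<le> (2 * real n - 1) * (2 * h ^ 3 / 3)"
    using A(4) h(1) by (intro mult_right_mono) auto
  \<comment> \<open>For \<open>e = h\<close> the product vanishes wherever \<open>m\<close> lies;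
    otherwise \<open>m \<le> 2 - e\<close> makes both factors nonnegative.\<close>
  have slope: "0 \<le> (e\<^sup>2 - h\<^sup>2) * (2 - e - m)"
    using me
  proof
    assume "m \<le> 2 - e"
    moreover have "h\<^sup>2 \<le> e\<^sup>2" using h by (intro power_mono) auto
    ultimately show ?thesis by simp
  qed simp
  have "h\<^sup>2 * ((2 * real n - 1) * h) = h\<^sup>2 * (2 - e)" by (simp only: h(3))
  then have h3: "(2 * real n - 1) * h ^ 3 = h\<^sup>2 * (2 - e)"
    by (simp add: power3_eq_cube power2_eq_square algebra_simps)
  \<comment> \<open>The combined bound is affine in \<open>m\<close> and equals the candidate's
    value at \<open>m = 2 - e\<close>; the slope term is the deviation from it.\<close>
  have id: "((2 * real n - 1) * h ^ 3 + e ^ 3) / 3 + (e\<^sup>2 - h\<^sup>2) * (2 - e - m) =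
    h\<^sup>2 * m - (2 * real n - 1) * (2 * h ^ 3 / 3) + (e\<^sup>2 * (2 - m) - 2 * e ^ 3 / 3)"
  proof -
    have "(2 * real n - 1) * (2 * h ^ 3 / 3) = 2 / 3 * (h\<^sup>2 * (2 - e))"
      using h3 by simp
    then show ?thesis unfolding h3
      by (simp add: power3_eq_cube power2_eq_square field_simps)
  qed
  show "((2 * real n - 1) * h ^ 3 + e ^ 3) / 3 \<le> integral {0..2} (sqdist A)"
    unfolding int using ge tail mono slope id by linarith
  assume "integral {0..2} (sqdist A) = ((2 * real n - 1) * h ^ 3 + e ^ 3) / 3" "card A = n"
  \<comment> \<open>With \<open>card A = n\<close>, any slack in \<open>ge\<close> would push the
    integral above the target value.\<close>
  then have "I = h\<^sup>2 * m - (2 * real (card A) - 1) * (2 * h ^ 3 / 3)"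
    using int ge tail mono slope id by linarith
  then show "A = odd_multiples h n" using eq \<open>card A = n\<close> by simp
qed

text \<open>The last point is \<open>2 - e\<close>, so a tail of length \<open>e\<close> completes
  the sum and the lower bound is attained.\<close>

lemma integral_sqdist_segment_odd_multiples:
  assumes "1 \<le> n" "0 < h" "0 \<le> e" "(2 * real n - 1) * h = 2 - e"
  shows "integral {0..2} (sqdist (odd_multiples h n)) = ((2 * real n - 1) * h ^ 3 + e ^ 3) / 3"
proof -
  have M: "Max (odd_multiples h n) = 2 - e"
    using Max_odd_multiples[of h n] assms by simp
  have "0 \<le> (2 * real n - 1) * h" using assms by (intro mult_nonneg_nonneg) auto
  then have "(sqdist (odd_multiples h n) has_integral
      (2 * real n - 1) * h ^ 3 / 3 + (2 - (2 - e)) ^ 3 / 3) {0..2}"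
    unfolding M[symmetric]
    using has_integral_sqdist_odd_multiples[of h n] odd_multiples_basic[OF assms(1)] assms
    by (intro has_integral_sqdist_tail) (auto simp: M)
  then show ?thesis by (simp add: integral_unique add_divide_distrib)
qed

section \<open>From the plane to the line\<close>

lemma integral_uniform_measure_atLeastAtMost:
  fixes f :: "real \<Rightarrow> real"
  assumes "continuous_on UNIV f" "p < q"
  shows "(\<integral>x. f x \<partial>uniform_measure lborel {p..q}) = integral {p..q} f / (q - p)"
proof -
  have [measurable]: "f \<in> borel_measurable borel"
    using assms(1) by (rule borel_measurable_continuous_onI)
  have "uniform_measure lborel {p..q} = density lborel (\<lambda>x. ennreal (indicator {p..q} x / (q - p)))"
    unfolding uniform_measure_def using assms(2)
    by (intro arg_cong2[where f = density] ext refl)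
       (auto simp: divide_ennreal split: split_indicator simp flip: ennreal_1)
  then have "(\<integral>x. f x \<partial>uniform_measure lborel {p..q})
      = (\<integral>x. (indicator {p..q} x / (q - p)) *\<^sub>R f x \<partial>lborel)"
    using assms(2) by (simp add: integral_density)
  also have "\<dots> = (LINT x:{p..q}|lborel. f x) / (q - p)"
    by (simp add: set_lebesgue_integral_def)
  also have "\<dots> = integral {p..q} f / (q - p)"
    using assms(1) by (subst set_borel_integral_eq_integral)
      (auto intro: borel_integrable_atLeastAtMost' continuous_on_subset)
  finally show ?thesis .
qed

text \<open>The squared distance from \<open>(x, 0)\<close> to \<open>(t, 1)\<close> is
  \<open>(x - t)\<^sup>2 + 1\<close>. The constant passes through the minimum, and the density 1/2
  gives the division by 2.\<close>

lemma distortion_uniform_segment: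
  assumes A: "finite A" "A \<noteq> {}"
  shows "distortion uniform_segment ((\<lambda>t. (t, 1)) ` A) = 1 + integral {0..2} (sqdist A) / 2"
proof -
  have "(\<lambda>x. MIN p\<in>(\<lambda>t. (t, 1)) ` A. (norm (x - p))\<^sup>2) \<in> borel_measurable (borel :: (real \<times> real) measure)"
    using A by (intro borel_measurable_Min) auto
  moreover have "(\<lambda>x. (x, 0)) \<in> uniform_measure lborel {0..2} \<rightarrow>\<^sub>M (borel :: (real \<times> real) measure)"
    by (simp add: borel_prod[symmetric] cong: measurable_cong_sets)
  ultimately have "distortion uniform_segment ((\<lambda>t. (t, 1)) ` A) =
      (\<integral>x. (MIN p\<in>(\<lambda>t. (t, 1::real)) ` A. (norm ((x, 0) - p))\<^sup>2) \<partial>uniform_measure lborel {0..2})"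
    unfolding distortion_def uniform_segment_def by (subst integral_distr) auto
  also have "(\<lambda>x. MIN p\<in>(\<lambda>t. (t, 1::real)) ` A. (norm ((x, 0) - p))\<^sup>2) = (\<lambda>x. sqdist A x + 1)"
    using A by (simp add: sqdist_def image_image norm_Pair Min_add_commute)
  also have "(\<integral>x. sqdist A x + 1 \<partial>uniform_measure lborel {0..2}) =
      integral {0..2} (\<lambda>x. sqdist A x + 1) / 2"
    by (subst integral_uniform_measure_atLeastAtMost)
       (auto intro!: continuous_intros continuous_on_sqdist A)
  also have "integral {0..2} (\<lambda>x. sqdist A x + 1) = integral {0..2} (sqdist A) + 2"
    by (subst Henstock_Kurzweil_Integration.integral_add)
       (auto intro!: integrable_continuous_interval continuous_on_sqdist A)
  finally show ?thesis by simp
qed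

lemma subset_constraint_segment:
  assumes "\<alpha> \<subseteq> constraint_segment"
  obtains A where "\<alpha> = (\<lambda>t. (t, 1)) ` A" "A \<subseteq> {0..28 / 15}" "card A = card \<alpha>"
proof
  show \<alpha>: "\<alpha> = (\<lambda>t. (t, 1)) ` (fst ` \<alpha>)"
    using assms by (force simp: constraint_segment_def image_iff)
  show "fst ` \<alpha> \<subseteq> {0..28 / 15}"
    using assms by (auto simp: constraint_segment_def)
  have "inj_on fst \<alpha>"
    using assms by (auto simp: constraint_segment_def inj_on_def)
  then show "card (fst ` \<alpha>) = card \<alpha>" by (rule card_image)
qed

section \<open>The constrained minimum\<close>

text \<open>Covers both regimes: \<open>e = h\<close> when \<open>n\<close> equal cells are
  admissible, and \<open>2 - e = 28 / 15\<close> when the last point sits at the right end of the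
  constraint. The 6 is the 3 of the cubes times the length 2 of the segment.\<close>

lemma constrained_quantization:
  assumes n: "1 \<le> n" and h: "0 < h" "h \<le> e" "(2 * real n - 1) * h = 2 - e" "2 - e \<le> 28 / 15"
    and e: "e = h \<or> 2 - e = 28 / 15"
  shows "constrained_quantization_error uniform_segment constraint_segment n =
      1 + ((2 * real n - 1) * h ^ 3 + e ^ 3) / 6"
    and "optimal_set_of_points uniform_segment constraint_segment n \<alpha> \<Longrightarrow> card \<alpha> = n \<Longrightarrow>
      \<alpha> = (\<lambda>t. (t, 1)) ` odd_multiples h n"
proof -
  define W where "W = ((2 * real n - 1) * h ^ 3 + e ^ 3) / 3"
  have e1: "1 + ((2 * real n - 1) * h ^ 3 + e ^ 3) / 6 = 1 + W / 2" by (simp add: W_def)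
  have low: "1 + W / 2 \<le> distortion uniform_segment \<alpha>"
    and low_eq: "distortion uniform_segment \<alpha> = 1 + W / 2 \<Longrightarrow> card \<alpha> = n \<Longrightarrow>
      \<alpha> = (\<lambda>t. (t, 1)) ` odd_multiples h n"
    if \<alpha>: "\<alpha> \<subseteq> constraint_segment" "1 \<le> card \<alpha>" "card \<alpha> \<le> n" for \<alpha>
  proof -
    obtain A where A: "\<alpha> = (\<lambda>t. (t, 1)) ` A" "A \<subseteq> {0..28 / 15}" "card A = card \<alpha>"
      using subset_constraint_segment[OF \<alpha>(1)] .
    \<comment> \<open>An infinite set has \<open>card\<close> 0, so
      \<open>1 \<le> card \<alpha>\<close> yields finiteness as well.\<close>
    have fin: "finite A" "A \<noteq> {}" using A(3) \<alpha>(2) card.infinite by force+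
    have A2: "A \<subseteq> {0..2}" "card A \<le> n" "e = h \<or> A \<subseteq> {..2 - e}"
      using A e \<alpha>(3) by auto
    note D = distortion_uniform_segment[OF fin, folded A(1)]
    note L = integral_sqdist_segment_lower_bound[OF fin A2(1,2) h(1-3) A2(3), folded W_def]
    show "1 + W / 2 \<le> distortion uniform_segment \<alpha>" using D L(1) by simp
    assume "distortion uniform_segment \<alpha> = 1 + W / 2" "card \<alpha> = n"
    then show "\<alpha> = (\<lambda>t. (t, 1)) ` odd_multiples h n"
      using D L(2) A(1,3) by auto
  qed
  \<comment> \<open>The set attaining the bound; its largest abscissa is \<open>2 - e\<close>, which
    the hypotheses keep within the constraint.\<close>
  define \<beta> :: "(real \<times> real) set" where "\<beta> = (\<lambda>t. (t, 1)) ` odd_multiples h n"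
  have odd: "finite (odd_multiples h n)" "odd_multiples h n \<noteq> {}"
    using odd_multiples_basic[OF n] by auto
  have "t \<le> 28 / 15" if "t \<in> odd_multiples h n" for t
    using Max_ge[OF odd(1) that] Max_odd_multiples[of h n] h n by auto
  moreover have "0 \<le> t" if "t \<in> odd_multiples h n" for t
    using that h(1) by (auto simp: odd_multiples_def)
  ultimately have "\<beta> \<subseteq> constraint_segment" by (auto simp: \<beta>_def constraint_segment_def)
  moreover have "finite \<beta>" "\<beta> \<noteq> {}" using odd by (auto simp: \<beta>_def)
  moreover have "card \<beta> \<le> n"
  proof -
    have "card \<beta> \<le> card (odd_multiples h n)" unfolding \<beta>_def by (rule card_image_le[OF odd(1)])
    also have "\<dots> \<le> card {1..n}" unfolding odd_multiples_def by (rule card_image_le) simp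
    finally show ?thesis by simp
  qed
  moreover have "distortion uniform_segment \<beta> = 1 + W / 2"
    using distortion_uniform_segment[OF odd] integral_sqdist_segment_odd_multiples[of n h e] n h
    by (simp add: \<beta>_def W_def)
  ultimately have mem: "1 + W / 2 \<in> {distortion uniform_segment \<alpha> | \<alpha>.
      \<alpha> \<subseteq> constraint_segment \<and> finite \<alpha> \<and> 1 \<le> card \<alpha> \<and> card \<alpha> \<le> n}"
    by (force simp: Suc_le_eq card_gt_0_iff)
  have V: "constrained_quantization_error uniform_segment constraint_segment n = 1 + W / 2"
    unfolding constrained_quantization_error_def
    by (rule cInf_eq_minimum[OF mem]) (use low in auto)
  then show "constrained_quantization_error uniform_segment constraint_segment n =
      1 + ((2 * real n - 1) * h ^ 3 + e ^ 3) / 6" by (simp only: e1)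
  assume "optimal_set_of_points uniform_segment constraint_segment n \<alpha>" "card \<alpha> = n"
  then show "\<alpha> = (\<lambda>t. (t, 1)) ` odd_multiples h n"
    unfolding optimal_set_of_points_def V using low_eq by blast
qed

text \<open>An increasing enumeration of a finite set is its sorted list, which is unique. This
  turns equality of sets into equality of the individual coordinates.\<close>

lemma strict_mono_on_image_unique:
  fixes a b :: "nat \<Rightarrow> 'a::linorder"
  assumes "strict_mono_on {1..n} a" "strict_mono_on {1..n} b" "a ` {1..n} = b ` {1..n}"
    and "i \<in> {1..n}"
  shows "a i = b i"
proof -
  have *: "sorted_wrt (<) (map f [1..<Suc n])" if "strict_mono_on {1..n} f" for f :: "nat \<Rightarrow> 'a"
    using that by (auto simp: sorted_wrt_iff_nth_less strict_mono_on_def simp del: upt_Suc)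
  have "map a [1..<Suc n] = map b [1..<Suc n]"
    using *[OF assms(1)] *[OF assms(2)] assms(3)
    by (intro strict_sorted_equal) (auto simp: atLeastLessThanSuc_atLeastAtMost simp del: upt_Suc)
  then show ?thesis using assms(4) by (simp add: map_eq_conv del: upt_Suc)
qed

theorem theorem3p9:
  shows
    "(\<forall>(n::nat) (\<alpha> :: (real \<times> real) set) (a :: nat \<Rightarrow> real).
        1 \<le> n \<and> optimal_set_of_points uniform_segment constraint_segment n \<alpha> \<and>
        \<alpha> = {(a i, 1) | i. 1 \<le> i \<and> i \<le> n} \<and>
        0 \<le> a 1 \<and> strict_mono_on {1..n} a \<and> a n \<le> 28 / 15 \<longrightarrow>
          (n = 1 \<longrightarrow> \<alpha> = {(1, 1)}) \<and>
          (n \<le> 7 \<longrightarrow> \<alpha> = {((2 * real i - 1) / real n, 1) | i. 1 \<le> i \<and> i \<le> n}) \<and>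
          (8 \<le> n \<longrightarrow>
             (\<forall>i. 1 \<le> i \<and> i \<le> n - 1 \<longrightarrow>
                a i = 28 * (2 * real i - 1) / (15 * (2 * real n - 1))) \<and>
             a n = 28 / 15))
     \<and> (\<forall>n::nat. 8 \<le> n \<longrightarrow>
          constrained_quantization_error uniform_segment constraint_segment n =
            7 * (5788 * (real n - 1) * real n + 3015) / (10125 * (1 - 2 * real n)\<^sup>2))"
proof (intro conjI allI impI; (elim conjE)?)
  fix n :: nat and \<alpha> :: "(real \<times> real) set" and a :: "nat \<Rightarrow> real"
  assume n: "1 \<le> n" and opt: "optimal_set_of_points uniform_segment constraint_segment n \<alpha>"
    and \<alpha>: "\<alpha> = {(a i, 1) | i. 1 \<le> i \<and> i \<le> n}" and mono: "strict_mono_on {1..n} a"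
  have \<alpha>': "\<alpha> = (\<lambda>t. (t, 1)) ` (a ` {1..n})" by (auto simp: \<alpha>)
  \<comment> \<open>Optimality only bounds the cardinality by \<open>n\<close>, while the uniqueness
    result needs exactly \<open>n\<close> points.\<close>
  have card: "card \<alpha> = n"
  proof -
    have "inj_on (\<lambda>t. (t, 1::real)) (a ` {1..n})" by (simp add: inj_on_def)
    then show ?thesis
      unfolding \<alpha>' by (simp only: card_image strict_mono_on_imp_inj_on[OF mono] card_atLeastAtMost)
  qed
  have small: "\<alpha> = {((2 * real i - 1) / real n, 1) | i. 1 \<le> i \<and> i \<le> n}" if "n \<le> 7"
  proof -
    \<comment> \<open>Equal cells: the last point is \<open>2 - 1 / real n\<close>, which is at most
      28/15 exactly when \<open>n \<le> 7\<close>.\<close>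
    have "\<alpha> = (\<lambda>t. (t, 1)) ` odd_multiples (1 / real n) n"
      by (rule constrained_quantization(2)[OF n, where e = "1 / real n"])
         (use n that opt card in \<open>auto simp: field_simps\<close>)
    then show ?thesis by (auto simp: odd_multiples_def)
  qed
  then show "n \<le> 7 \<Longrightarrow> \<alpha> = {((2 * real i - 1) / real n, 1) | i. 1 \<le> i \<and> i \<le> n}" .
  show "\<alpha> = {(1, 1)}" if "n = 1"
    using small that by auto
  have large: "a i = 28 * (2 * real i - 1) / (15 * (2 * real n - 1))" if "8 \<le> n" "i \<in> {1..n}" for i
  proof -
    \<comment> \<open>This solves \<open>(2 * real n - 1) * h = 28 / 15\<close>, and
      \<open>e = 2 / 15\<close> is what remains up to 2. The condition \<open>h \<le> e\<close>
      reads \<open>2 * real n - 1 \<ge> 14\<close>, which is where \<open>8 \<le> n\<close>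
      enters.\<close>
    define h where "h = 28 / (15 * (2 * real n - 1))"
    have "h > 0" using n by (simp add: h_def)
    have "\<alpha> = (\<lambda>t. (t, 1)) ` odd_multiples h n"
      by (rule constrained_quantization(2)[OF n, where e = "2 / 15"])
         (use that opt card in \<open>auto simp: h_def field_simps\<close>)
    then have "a ` {1..n} = odd_multiples h n"
      by (simp add: \<alpha>' inj_image_eq_iff inj_on_def)
    moreover have "strict_mono_on {1..n} (\<lambda>i. (2 * real i - 1) * h)"
      using \<open>h > 0\<close> by (auto simp: strict_mono_on_def)
    ultimately have "a i = (2 * real i - 1) * h"
      unfolding odd_multiples_def using mono that(2)
      by (intro strict_mono_on_image_unique[of n a]) auto
    then show ?thesis by (simp add: h_def)
  qed
  show "a i = 28 * (2 * real i - 1) / (15 * (2 * real n - 1))" if "8 \<le> n" "1 \<le> i" "i \<le> n - 1" for i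
    using large that by simp
  show "a n = 28 / 15" if "8 \<le> n"
  proof -
    \<comment> \<open>The general formula also covers \<open>i = n\<close>, where the odd factor
      cancels.\<close>
    have "2 * real n - 1 \<noteq> 0" using n by simp
    then have "28 * (2 * real n - 1) / (15 * (2 * real n - 1)) = 28 / 15"
      by (rule mult_divide_mult_cancel_right)
    moreover have "n \<in> {1..n}" using n by simp
    ultimately show ?thesis using large[OF that] by metis
  qed
next
  fix n :: nat assume n: "8 \<le> n"
  define h where "h = 28 / (15 * (2 * real n - 1))"
  have "constrained_quantization_error uniform_segment constraint_segment n =
      1 + ((2 * real n - 1) * h ^ 3 + (2 / 15) ^ 3) / 6"
    by (rule constrained_quantization(1)) (use n in \<open>auto simp: h_def field_simps\<close>)
  also have "\<dots> = 7 * (5788 * (real n - 1) * real n + 3015) / (10125 * (1 - 2 * real n)\<^sup>2)"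
  proof -
    define y where "y = 2 * real n - 1"
    have "y > 0" using n by (simp add: y_def)
    \<comment> \<open>Since \<open>(real n - 1) * real n = (y\<^sup>2 - 1) / 4\<close>, the
      coefficients are 10129 = 7 * 5788 / 4 and 10976 = 7 * 3015 - 10129.\<close>
    have den: "(1 - 2 * real n)\<^sup>2 = y\<^sup>2"
      and num: "7 * (5788 * (real n - 1) * real n + 3015) = 10129 * y\<^sup>2 + 10976"
      by (simp_all add: y_def power2_eq_square algebra_simps)
    show ?thesis
      unfolding h_def den num unfolding y_def[symmetric]
      using \<open>y > 0\<close> by (simp add: power3_eq_cube power2_eq_square field_simps)
  qed
  finally show "constrained_quantization_error uniform_segment constraint_segment n =
      7 * (5788 * (real n - 1) * real n + 3015) / (10125 * (1 - 2 * real n)\<^sup>2)" .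
qed

end
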